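(* Let $p$ be a prime with $p\equiv 1\pmod 4$, let $s$ be a non-negative integer, and let $q=p^{2s+1}$. Then the clique number of the Paley graph $P_q$ satisfies $$\omega(P_q)\leq \min\left(p^s\left\lceil\sqrt{\frac{p}{2}}\right\rceil,\ \sqrt{\frac{q}{2}}+\frac{p^s+1}{4}+\frac{\sqrt{2p}}{32}\,p^{s-1}\right).$$
   Context: For a prime power $q\equiv 1\pmod 4$, the Paley graph $P_q$ is the undirected graph whose vertices are the elements of the finite field $\mathbb{F}_q$, two vertices being adjacent if and only if their difference is a quadratic residue in $\mathbb{F}_q^*=\mathbb{F}_q\setminus\{0\}$ (i.e. a nonzero square). For an undirected graph $G$, the clique number $\omega(G)$ is the size of a maximum clique of $G$. *)

theory Defs
  imports
    Complex_Main
    "HOL-Library.Ramsey"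
    "HOL-Computational_Algebra.Computational_Algebra"
begin

text \<open>
  A finite simple graph is given by its vertex set and its set of edges, an edge being a
  two-element set of vertices; this is the representation on which \<^const>\<open>clique\<close> is based.
\<close>

definition clique_number :: "'a set \<Rightarrow> 'a set set \<Rightarrow> nat" where
  "clique_number V E = Max {card C | C. C \<subseteq> V \<and> clique C E}"

definition quadratic_residue :: "'a::field \<Rightarrow> bool" where
  "quadratic_residue a \<longleftrightarrow> a \<noteq> 0 \<and> (\<exists>y. a = y ^ 2)"

text \<open>
  The vertex set is \<^const>\<open>UNIV\<close>. Since \<open>- 1\<close> is a square when the field has
  \<open>q \<equiv> 1 (mod 4)\<close> elements, the order of \<open>x\<close> and \<open>y\<close> in the difference is then immaterial.
\<close>

definition paley_edges :: "'a::field set set" where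
  "paley_edges = {{x, y} | x y. quadratic_residue (x - y)}"

end

theory Submission
  imports Defs
begin

text \<open>
  Let \<open>h = (q - 1) / 2\<close>. If \<open>A\<close> is a clique, then \<open>(x - y) ^ h = 1\<close> for all distinct
  \<open>x, y \<in> A\<close>. For a subset \<open>B\<close> of \<open>A\<close> with \<open>m + 1\<close> elements, let \<open>c\<^sub>b\<close> be the weights for which
  \<open>\<Sum>b\<in>B. c\<^sub>b * g(b)\<close> is the coefficient of degree \<open>m\<close> of each polynomial \<open>g\<close> of degree at most
  \<open>m\<close> (Lagrange interpolation). The polynomial
  \<open>F(X) = (\<Sum>b\<in>B. c\<^sub>b * (X - b) ^ (m + h)) - (- 1) ^ m\<close> has degree \<open>h\<close>, unless the characteristic
  divides \<open>m + h choose m\<close>. It vanishes to order \<open>m + 1\<close> on \<open>A - B\<close> and to order \<open>m\<close> on \<open>B\<close>,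
  so \<open>(card A - 1) * (m + 1) \<le> h\<close> (the Stepanov method of Hanson and Petridis).

  All base \<open>p\<close> digits of \<open>h\<close> are \<open>(p - 1) / 2\<close>, so that the binomial coefficient is not divisible
  by \<open>p\<close> as soon as the digits of \<open>m\<close> are at most \<open>(p - 1) / 2\<close>. The first bound follows from
  \<open>m = \<lceil>sqrt (p / 2)\<rceil> * p ^ s\<close>. For the second one, write \<open>card A - 1 = a * p ^ s + r\<close> with
  \<open>r < p ^ s\<close> and take \<open>m = a * p ^ s\<close> or \<open>m = a * p ^ s + (p ^ s - 1) / 2\<close>, whichever is the
  largest that does not exceed \<open>card A - 1\<close>: the first bound gives \<open>a \<le> (p - 1) / 2\<close>, and
  \<open>card A \<le> m + 1 + (p ^ s - 1) / 2\<close> turns the inequality into a quadratic one for \<open>card A\<close>.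
\<close>

section \<open>Binomial coefficients modulo a prime\<close>

text \<open>Legendre's formula in recursive form: only the multiples of \<open>p\<close> up to
  \<open>p * A\<close> contribute, and removing one factor \<open>p\<close> from each of them leaves
  \<open>fact A\<close>.\<close>

lemma multiplicity_fact_mult_add:
  fixes p :: nat
  assumes "prime p" "a < p"
  shows "multiplicity p (fact (p * A + a) :: nat) = A + multiplicity p (fact A :: nat)"
proof -
  have p: "prime_elem p" using assms by simp
  have low: "multiplicity p (fact (p * A + a) :: nat) = multiplicity p (fact (p * A) :: nat)"
    if "a < p" for A a
    using that
  proof (induction a)
    case (Suc a)
    have "\<not> p dvd Suc (p * A + a)"
    proof
      assume "p dvd Suc (p * A + a)"
      hence "p dvd p * A + Suc a" by simp
      hence "p dvd Suc a" by (subst (asm) dvd_add_right_iff) auto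
      thus False using Suc.prems by (auto dest: dvd_imp_le)
    qed
    hence "multiplicity p (Suc (p * A + a)) = 0" by (rule not_dvd_imp_multiplicity_0)
    moreover have "(fact (p * A + Suc a) :: nat) = Suc (p * A + a) * fact (p * A + a)"
      by simp
    ultimately show ?case
      using Suc p by (simp add: prime_elem_multiplicity_mult_distrib del: fact_Suc mult_Suc)
  qed simp
  have "multiplicity p (fact (p * A) :: nat) = A + multiplicity p (fact A :: nat)"
  proof (induction A)
    case (Suc A)
    have pos: "p > 0" using assms by simp
    have e: "p * Suc A = Suc (p * A + (p - 1))" using pos by simp
    have "(fact (p * Suc A) :: nat) = p * Suc A * fact (p * A + (p - 1))"
      unfolding e by (simp only: fact_Suc of_nat_id)
    also have "multiplicity p \<dots> = 1 + multiplicity p (Suc A) + multiplicity p (fact (p * A) :: nat)"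
      using p pos low[of "p - 1" A]
      by (simp add: prime_elem_multiplicity_mult_distrib del: mult_Suc mult_Suc_right)
    also have "\<dots> = Suc A + multiplicity p (fact (Suc A) :: nat)"
      using p Suc
      by (simp add: prime_elem_multiplicity_mult_distrib del: mult_Suc)
    finally show ?case .
  qed simp
  thus ?thesis using low[OF assms(2)] by simp
qed

lemma multiplicity_binomial:
  fixes p :: nat
  assumes "prime p"
  shows "multiplicity p (fact (a + b) :: nat)
    = multiplicity p (fact a :: nat) + multiplicity p (fact b :: nat) + multiplicity p (a + b choose a)"
proof -
  have "(fact (a + b) :: nat) = fact a * fact b * (a + b choose a)"
    using binomial_fact_lemma[of a "a + b"] by simp
  moreover have "a + b choose a \<noteq> 0" by simp
  ultimately show ?thesis using assms
    by (simp add: prime_elem_multiplicity_mult_distrib)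
qed

text \<open>One step of Kummer's theorem: since \<open>a + b < p\<close> the last digits add without
  a carry, so the linear terms \<open>A\<close>, \<open>B\<close> and \<open>A + B\<close> of the
  factorial recursion cancel.\<close>

lemma not_dvd_binomial_append_digits:
  fixes p :: nat
  assumes p: "prime p" and ab: "a + b < p" and "\<not> p dvd (A + B choose A)"
  shows "\<not> p dvd ((p * A + a) + (p * B + b) choose (p * A + a))"
proof -
  have "multiplicity p (fact (p * (A + B) + (a + b)) :: nat)
      = A + B + multiplicity p (fact (A + B) :: nat)"
    by (rule multiplicity_fact_mult_add[OF p ab])
  moreover have "p * (A + B) + (a + b) = (p * A + a) + (p * B + b)"
    by (simp add: algebra_simps)
  moreover have "multiplicity p (fact (p * A + a) :: nat) = A + multiplicity p (fact A :: nat)"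
    "multiplicity p (fact (p * B + b) :: nat) = B + multiplicity p (fact B :: nat)"
    using p ab by (intro multiplicity_fact_mult_add; simp)+
  moreover have "multiplicity p (A + B choose A) = 0"
    using assms(3) by (rule not_dvd_imp_multiplicity_0)
  ultimately have "multiplicity p ((p * A + a) + (p * B + b) choose (p * A + a)) = 0"
    using multiplicity_binomial[OF p, of A B] multiplicity_binomial[OF p, of "p * A + a" "p * B + b"]
    by simp
  moreover have "(p * A + a) + (p * B + b) choose (p * A + a) \<noteq> 0" by simp
  ultimately show ?thesis using p
    by (subst (asm) multiplicity_eq_zero_iff) auto
qed

lemma half_power_Suc:
  fixes p :: nat
  assumes "odd p"
  shows "(p ^ Suc k - 1) div 2 = p * ((p ^ k - 1) div 2) + (p - 1) div 2"
proof -
  obtain d where d: "p = 2 * d + 1" using assms by (elim oddE)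
  have "odd (p ^ k)" using assms by simp
  then obtain e where e: "p ^ k = 2 * e + 1" by (elim oddE)
  have "p ^ Suc k - 1 = 2 * (p * e + d)" using d e by (simp add: algebra_simps)
  thus ?thesis using d e by simp
qed

text \<open>The \<open>k\<close> low digits of \<open>(p ^ (j + k) - 1) div 2\<close> are
  \<open>(p - 1) div 2\<close> and those of \<open>r\<close> are all \<open>0\<close> or all
  \<open>(p - 1) div 2\<close>. Two such digits sum to at most \<open>p - 1\<close>, so the
  induction appends them one by one without a carry.\<close>

lemma not_dvd_binomial_half_power:
  fixes p :: nat
  assumes "prime p" "odd p" "\<not> p dvd (A + (p ^ j - 1) div 2 choose A)"
    and "r = 0 \<or> r = (p ^ k - 1) div 2"
  shows "\<not> p dvd (A * p ^ k + r + (p ^ (j + k) - 1) div 2 choose (A * p ^ k + r))"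
  using assms(4)
proof (induction k arbitrary: r)
  case 0
  thus ?case using assms(3) by auto
next
  case (Suc k)
  let ?d = "(p - 1) div 2"
  have p2: "?d + ?d < p" using assms(1) prime_gt_0_nat[of p] by linarith
  obtain r' a where r': "r' = 0 \<or> r' = (p ^ k - 1) div 2" and a: "a \<le> ?d" and r: "r = p * r' + a"
    using Suc.prems
  proof
    assume "r = 0" thus ?thesis using that[of 0 0] by simp
  next
    assume "r = (p ^ Suc k - 1) div 2"
    thus ?thesis using that[of "(p ^ k - 1) div 2" ?d] half_power_Suc[OF assms(2), of k] by simp
  qed
  have "a + ?d < p" using a p2 by linarith
  from not_dvd_binomial_append_digits[OF assms(1) this Suc.IH[OF r']]
  show ?case
    using half_power_Suc[OF assms(2), of "j + k"] by (simp add: r algebra_simps)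
qed

section \<open>The polynomial method\<close>

text \<open>Compare coefficients of degree \<open>m\<close> in the interpolation formula for
  \<open>g\<close> at the \<open>m + 1\<close> nodes of \<open>B\<close>: each product
  \<open>?L b\<close> is monic of degree \<open>m\<close>.\<close>

lemma Lagrange_leading_coeff:
  fixes B :: "'a :: field set" and g :: "'a poly"
  assumes "finite B" "card B = Suc m" "degree g \<le> m"
  shows "(\<Sum>b\<in>B. (\<Prod>c\<in>B - {b}. inverse (b - c)) * poly g b) = coeff g m"
proof -
  let ?w = "\<lambda>b. \<Prod>c\<in>B - {b}. inverse (b - c)"
  let ?L = "\<lambda>b. \<Prod>c\<in>B - {b}. [:- c, 1:]"
  let ?G = "\<Sum>b\<in>B. smult (?w b * poly g b) (?L b)"
  have deg: "degree (?L b) = m" if "b \<in> B" for b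
    using that assms by (subst degree_prod_eq_sum_degree) auto
  have lead: "coeff (?L b) m = 1" if "b \<in> B" for b
    using lead_coeff_prod[of "\<lambda>c. [:- c, 1:]" "B - {b}"] deg[OF that] by simp
  have "g = ?G"
  proof (rule poly_eqI_degree[where A = B])
    fix x assume x: "x \<in> B"
    have "poly ?G x = (\<Sum>b\<in>B. if b = x then poly g b else 0)"
      unfolding poly_sum
    proof (rule sum.cong)
      fix b assume b: "b \<in> B"
      show "poly (smult (?w b * poly g b) (?L b)) x = (if b = x then poly g b else 0)"
      proof (cases "b = x")
        case True
        have "?w x * (\<Prod>c\<in>B - {x}. x - c) = (\<Prod>c\<in>B - {x}. inverse (x - c) * (x - c))"
          by (simp add: prod.distrib)
        also have "\<dots> = 1" by (intro prod.neutral ballI left_inverse) auto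
        finally show ?thesis using True by (simp add: poly_prod mult_ac)
      next
        case False
        hence "(\<Prod>c\<in>B - {b}. x - c) = 0" using x assms(1) by (intro prod_zero) auto
        thus ?thesis using False by (simp add: poly_prod)
      qed
    qed simp
    also have "\<dots> = poly g x" using x assms(1) by simp
    finally show "poly g x = poly ?G x" by simp
  next
    show "degree g < card B" using assms by simp
    have "degree ?G \<le> m"
      using deg assms(1) by (intro degree_sum_le) (auto intro: order.trans[OF degree_smult_le])
    thus "degree ?G < card B" using assms(2) by simp
  qed
  hence "coeff g m = coeff ?G m" by simp
  also have "\<dots> = (\<Sum>b\<in>B. ?w b * poly g b)" using lead by (simp add: coeff_sum)
  finally show ?thesis by simp
qed

text \<open>Interpolate \<open>(u - X) ^ k\<close> as a polynomial in \<open>X\<close>. The weights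
  depend on \<open>B\<close> only, so they serve every \<open>u\<close> at once.\<close>

lemma ex_Lagrange_weights:
  fixes B :: "'a :: field set"
  assumes "finite B" "card B = Suc m"
  obtains c where "\<And>u k. k \<le> m \<Longrightarrow> (\<Sum>b\<in>B. c b * (u - b) ^ k) = (if k = m then (- 1) ^ m else 0)"
proof
  fix u :: 'a and k assume k: "k \<le> m"
  have deg: "degree ([:u, - 1:] ^ k) \<le> k"
    using degree_power_le[of "[:u, - 1:]" k] by simp
  have "coeff ([:u, - 1:] ^ k) m = (if k = m then (- 1) ^ m else 0)"
    using deg k by (auto simp: coeff_linear_poly_power intro!: coeff_eq_0)
  thus "(\<Sum>b\<in>B. (\<Prod>c\<in>B - {b}. inverse (b - c)) * (u - b) ^ k) = (if k = m then (- 1) ^ m else 0)"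
    using Lagrange_leading_coeff[OF assms, of "[:u, - 1:] ^ k"] deg k by simp
qed

lemma pcompose_power: "(f ^ n) \<circ>\<^sub>p g = (f \<circ>\<^sub>p g) ^ n"
  by (induction n) (simp_all add: pcompose_mult pcompose_1)

text \<open>Taylor coefficients at \<open>a\<close> are read off after a shift of the variable.
  Derivatives would bring in factorials, which may vanish in positive characteristic.\<close>

lemma le_order_if_shift_coeffs_0:
  fixes f :: "'a :: field poly"
  assumes "f \<noteq> 0" "\<And>k. k < n \<Longrightarrow> coeff (f \<circ>\<^sub>p [:a, 1:]) k = 0"
  shows "n \<le> order a f"
proof -
  have "monom 1 n dvd f \<circ>\<^sub>p [:a, 1:]"
    using assms(2) by (simp add: monom_1_dvd_iff')
  hence "[:0, 1:] ^ n dvd f \<circ>\<^sub>p [:a, 1:]"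
    by (simp only: monom_altdef smult_1_left)
  then obtain g where g: "f \<circ>\<^sub>p [:a, 1:] = [:0, 1:] ^ n * g" by (elim dvdE)
  have "f = (f \<circ>\<^sub>p [:a, 1:]) \<circ>\<^sub>p [:- a, 1:]"
    by (simp flip: pcompose_assoc add: pcompose_pCons)
  also have "\<dots> = ([:- a, 1:]) ^ n * (g \<circ>\<^sub>p [:- a, 1:])"
    unfolding g by (simp add: pcompose_mult pcompose_power pcompose_pCons)
  finally have "[:- a, 1:] ^ n dvd f" by (metis dvd_triv_left)
  thus ?thesis using assms(1) by (simp add: order_divides)
qed

lemma card_mult_le_of_differences_roots_of_unity:
  fixes A B :: "'a :: field set"
  assumes "finite A" "B \<subseteq> A" "card B = Suc m" "h > 0"
    and root: "\<And>x y. x \<in> A \<Longrightarrow> y \<in> A \<Longrightarrow> x \<noteq> y \<Longrightarrow> (x - y) ^ h = 1"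
    and binom: "of_nat (m + h choose m) \<noteq> (0 :: 'a)"
  shows "(card A - 1) * Suc m \<le> h"
proof -
  have finB: "finite B" using assms finite_subset by blast
  obtain c where c: "\<And>u k. k \<le> m \<Longrightarrow> (\<Sum>b\<in>B. c b * (u - b) ^ k) = (if k = m then (- 1) ^ m else (0 :: 'a))"
    using ex_Lagrange_weights[OF finB assms(3)] by blast
  define F where "F = (\<Sum>b\<in>B. smult (c b) ([:- b, 1:] ^ (m + h))) - [:(- 1) ^ m:]"
  have shift: "F \<circ>\<^sub>p [:u, 1:] = (\<Sum>b\<in>B. smult (c b) ([:u - b, 1:] ^ (m + h))) - [:(- 1) ^ m:]" for u
    unfolding F_def
    by (simp add: pcompose_diff pcompose_sum pcompose_smult pcompose_power pcompose_pCons algebra_simps)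
  have coeff_shift: "coeff (F \<circ>\<^sub>p [:u, 1:]) k =
      of_nat (m + h choose k) * (\<Sum>b\<in>B. c b * (u - b) ^ (m + h - k)) - (if k = 0 then (- 1) ^ m else 0)"
    if "k \<le> m + h" for u k
    using that
    by (simp add: shift coeff_sum coeff_linear_poly_power sum_distrib_left mult_ac coeff_pCons
        split: nat.splits)
  \<comment> \<open>At degree \<open>h\<close> the remaining exponent is exactly \<open>m\<close>,
    the one power that the weights do not annihilate; degrees above \<open>h\<close> leave smaller
    exponents.\<close>
  have "coeff F h = of_nat (m + h choose h) * (- 1) ^ m"
    using coeff_shift[of h 0] c[of m 0] \<open>h > 0\<close> by simp
  moreover have "m + h choose h = m + h choose m"
    using binomial_symmetric[of h "m + h"] by simp
  ultimately have "coeff F h \<noteq> 0" using binom by simp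
  hence F0: "F \<noteq> 0" by auto
  have "degree F \<le> h"
  proof (rule degree_le, intro allI impI)
    fix k assume k: "h < k"
    show "coeff F k = 0"
    proof (cases "k \<le> m + h")
      case True
      have "m + h - k \<le> m" "m + h - k \<noteq> m" using k True by auto
      thus ?thesis using coeff_shift[of k 0] c[of "m + h - k" 0] k True by simp
    next
      case False
      have "degree ([:- b, 1:] ^ (m + h)) < k" for b :: 'a
        using False by (simp add: degree_linear_power)
      thus ?thesis using k
        by (simp add: F_def coeff_sum coeff_eq_0 coeff_pCons split: nat.splits)
    qed
  qed
  have vanish: "coeff (F \<circ>\<^sub>p [:a, 1:]) k = 0" if "a \<in> A" "k < m \<or> a \<notin> B \<and> k \<le> m" for a k
  proof -
    \<comment> \<open>The factor \<open>(a - b) ^ h\<close> is \<open>1\<close> for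
      \<open>b \<noteq> a\<close>. For \<open>b = a\<close> both powers must vanish, which forces
      \<open>k < m\<close>: hence the order is one less on \<open>B\<close>.\<close>
    have "(\<Sum>b\<in>B. c b * (a - b) ^ (m + h - k)) = (\<Sum>b\<in>B. c b * (a - b) ^ (m - k))"
    proof (rule sum.cong)
      fix b assume b: "b \<in> B"
      show "c b * (a - b) ^ (m + h - k) = c b * (a - b) ^ (m - k)"
      proof (cases "a = b")
        case True
        thus ?thesis using that b by (auto simp: power_0_left)
      next
        case False
        have "m + h - k = h + (m - k)" using that by auto
        thus ?thesis using root[of a b] that b False assms(2) by (auto simp: power_add)
      qed
    qed simp
    also have "\<dots> = (if k = 0 then (- 1) ^ m else 0)"
      using c[of "m - k" a] that by auto
    finally show ?thesis using coeff_shift[of k a] that by auto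
  qed
  have ordB: "m \<le> order a F" if "a \<in> B" for a
    using le_order_if_shift_coeffs_0[OF F0] vanish that assms(2) by blast
  have ordA: "Suc m \<le> order a F" if "a \<in> A - B" for a
    using le_order_if_shift_coeffs_0[OF F0, of "Suc m" a] vanish that
    by (simp add: less_Suc_eq_le)
  have finR: "finite {x. poly F x = 0}" using F0 by (rule poly_roots_finite)
  have "card A = card B + card (A - B)"
    using assms(1,2) finB by (simp add: card_Diff_subset card_mono)
  \<comment> \<open>The order lost at each of the \<open>m + 1\<close> points of \<open>B\<close>
    adds up to \<open>Suc m\<close>, which turns \<open>card A\<close> into
    \<open>card A - 1\<close>.\<close>
  hence "(card A - 1) * Suc m = card B * m + card (A - B) * Suc m"
    using assms(3) by (simp add: algebra_simps)
  also have "\<dots> = (\<Sum>a\<in>B. m) + (\<Sum>a\<in>A - B. Suc m)" by simp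
  also have "\<dots> \<le> (\<Sum>a\<in>B. order a F) + (\<Sum>a\<in>A - B. order a F)"
    using ordA ordB by (intro add_mono sum_mono) auto
  also have "\<dots> = (\<Sum>a\<in>A. order a F)"
    by (subst sum.subset_diff[OF assms(2,1)]) simp
  also have "\<dots> = (\<Sum>a\<in>A \<inter> {x. poly F x = 0}. order a F)"
    using assms(1) F0 by (intro sum.mono_neutral_right) (auto simp: order_root)
  also have "\<dots> \<le> (\<Sum>x | poly F x = 0. order x F)"
    using finR by (intro sum_mono2) auto
  also have "\<dots> \<le> degree F" using F0 by (rule sum_order_le_degree)
  also have "\<dots> \<le> h" by fact
  finally show ?thesis .
qed

section \<open>Cliques in Paley graphs\<close>

lemma quadratic_residue_power_half:
  fixes x :: "'a :: finite_field"
  assumes "quadratic_residue x" "card (UNIV :: 'a set) = 2 * h + 1"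
  shows "x ^ h = 1"
proof -
  obtain y where y: "x = y ^ 2" "y \<noteq> 0"
    using assms(1) by (auto simp: quadratic_residue_def)
  have "y ^ (2 * h + 1) = y"
    using finite_field_power_card_eq_same[of y] assms(2) by simp
  thus ?thesis using y by (simp add: power_mult)
qed

lemma paley_clique_power_half:
  fixes C :: "'a :: finite_field set"
  assumes "clique C paley_edges" "card (UNIV :: 'a set) = 2 * h + 1" "even h"
    and "x \<in> C" "y \<in> C" "x \<noteq> y"
  shows "(x - y) ^ h = 1"
proof -
  have "{x, y} \<in> paley_edges" using assms by (auto simp: clique_def)
  then obtain u v where uv: "{x, y} = {u, v}" "quadratic_residue (u - v)"
    by (auto simp: paley_edges_def)
  have "(u - v) ^ h = 1" using quadratic_residue_power_half[OF uv(2) assms(2)] .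
  moreover have "(x - y) ^ h = (y - x) ^ h"
    using assms(3) power_minus_even[of h "x - y"] by simp
  ultimately show ?thesis using uv(1) by (auto simp: doubleton_eq_iff)
qed

text \<open>Translation by \<open>1\<close> permutes the field; summing all elements before and
  after it shows that the cardinality is zero in the field.\<close>

lemma CHAR_eq_prime_of_card:
  assumes "prime p" "card (UNIV :: 'a :: finite_field set) = p ^ k"
  shows "CHAR('a) = p"
proof -
  have "(\<Sum>x\<in>UNIV. x + 1 :: 'a) = (\<Sum>x\<in>UNIV. x)"
    by (rule sum.reindex_bij_witness[of _ "\<lambda>x. x - 1" "\<lambda>x. x + 1"]) auto
  hence "of_nat (card (UNIV :: 'a set)) = (0 :: 'a)" by (simp add: sum.distrib)
  hence "CHAR('a) dvd p ^ k" by (simp only: of_nat_eq_0_iff_char_dvd assms(2))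
  hence "CHAR('a) dvd p" by (rule prime_dvd_power[OF CHAR_prime])
  thus ?thesis using assms(1) by (simp add: primes_dvd_imp_eq)
qed

lemma paley_clique_card_mult_le:
  fixes C :: "'a :: finite_field set"
  assumes "prime p" "p mod 4 = 1" "card (UNIV :: 'a set) = p ^ (2 * s + 1)"
    and "clique C paley_edges" "a \<le> (p - 1) div 2" "r = 0 \<or> r = (p ^ s - 1) div 2"
    and "a * p ^ s + r < card C"
  shows "(card C - 1) * (a * p ^ s + r + 1) \<le> (p ^ (2 * s + 1) - 1) div 2"
proof -
  let ?h = "(p ^ (2 * s + 1) - 1) div 2" and ?m = "a * p ^ s + r"
  \<comment> \<open>This makes \<open>?h\<close> even, so the sign of a difference does not affect
    its \<open>?h\<close>-th power.\<close>
  have "p ^ (2 * s + 1) mod 4 = (p mod 4) ^ (2 * s + 1) mod 4" by (simp only: power_mod)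
  also have "\<dots> = 1" unfolding assms(2) by simp
  finally have "p ^ (2 * s + 1) mod 4 = 1" .
  moreover have "p > 1" using assms(1) prime_gt_1_nat by blast
  hence "p ^ (2 * s + 1) > 1" by (intro one_less_power) auto
  ultimately have q: "p ^ (2 * s + 1) = 2 * ?h + 1" and h: "even ?h" "?h > 0" by presburger+
  have "odd p" using assms(2) by presburger
  \<comment> \<open>The top part of \<open>?m\<close> is the single digit \<open>a\<close>, written
    with an empty higher part \<open>0\<close>; it meets a digit \<open>(p - 1) div 2\<close>
    without a carry.\<close>
  have "\<not> p dvd (p * 0 + a + (p * ((p ^ s - 1) div 2) + (p - 1) div 2) choose (p * 0 + a))"
    using assms(1,5) \<open>p > 1\<close> by (intro not_dvd_binomial_append_digits) auto
  hence "\<not> p dvd (a + (p ^ (s + 1) - 1) div 2 choose a)"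
    using half_power_Suc[OF \<open>odd p\<close>, of s] by simp
  from not_dvd_binomial_half_power[OF assms(1) \<open>odd p\<close> this assms(6)]
  have "\<not> p dvd (?m + ?h choose ?m)" by (simp add: mult_2)
  hence binom: "of_nat (?m + ?h choose ?m) \<noteq> (0 :: 'a)"
    using CHAR_eq_prime_of_card[OF assms(1,3)] by (simp add: of_nat_eq_0_iff_char_dvd)
  obtain B where B: "B \<subseteq> C" "card B = Suc ?m"
    using assms(7) by (metis Suc_leI obtain_subset_with_card_n)
  have "(card C - 1) * Suc ?m \<le> ?h"
  proof (rule card_mult_le_of_differences_roots_of_unity[OF _ B h(2) _ binom])
    show "(x - y) ^ ?h = 1" if "x \<in> C" "y \<in> C" "x \<noteq> y" for x y
      using paley_clique_power_half[OF assms(4) _ h(1) that] assms(3) q by simp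
  qed simp
  thus ?thesis by simp
qed

text \<open>Makes the ceiling an admissible digit \<open>a\<close> in
  \<open>paley_clique_card_mult_le\<close>. With \<open>p = 2 * d + 1\<close> it amounts to
  \<open>2 * d + 1 \<le> 2 * d ^ 2\<close>, true since \<open>p \<ge> 5\<close>.\<close>

lemma ceiling_sqrt_half_le:
  fixes p :: nat
  assumes "prime p" "p mod 4 = 1"
  shows "nat \<lceil>sqrt (real p / 2)\<rceil> \<le> (p - 1) div 2"
proof -
  have "p \<noteq> 1" using assms(1) by auto
  hence p5: "p \<ge> 5" using assms(2) by presburger
  have "odd p" using assms(2) by presburger
  then obtain d where d: "p = 2 * d + 1" by (elim oddE)
  have "sqrt (real p / 2) \<le> real d"
  proof (rule real_le_lsqrt)
    have d2: "real d \<ge> 2" using d p5 by simp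
    hence "real d * real d \<ge> 2 * real d" by (intro mult_right_mono) auto
    with d2 have "2 * real d + 1 \<le> 2 * (real d)\<^sup>2" unfolding power2_eq_square by linarith
    thus "real p / 2 \<le> (real d)\<^sup>2" by (simp add: d)
  qed auto
  thus ?thesis using d by (simp add: nat_le_iff ceiling_le_iff)
qed

lemma paley_clique_card_le_ceiling:
  fixes C :: "'a :: finite_field set"
  assumes "prime p" "p mod 4 = 1" "card (UNIV :: 'a set) = p ^ (2 * s + 1)"
    and "clique C paley_edges"
  shows "card C \<le> p ^ s * nat \<lceil>sqrt (real p / 2)\<rceil>"
proof (rule ccontr)
  let ?M = "nat \<lceil>sqrt (real p / 2)\<rceil>"
  assume "\<not> card C \<le> p ^ s * ?M"
  hence large: "?M * p ^ s + 0 < card C" by (simp add: mult_ac)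
  have p0: "p > 0" using assms(1) prime_gt_0_nat by blast
  have "(card C - 1) * (?M * p ^ s + 1) \<le> (p ^ (2 * s + 1) - 1) div 2"
    using paley_clique_card_mult_le[OF assms ceiling_sqrt_half_le[OF assms(1,2)] disjI1[OF refl] large]
    by simp
  \<comment> \<open>A clique this large would have both factors at least \<open>?M * p ^ s\<close>,
    forcing \<open>?M ^ 2 < p / 2\<close> against the choice of \<open>?M\<close>.\<close>
  moreover have "?M * p ^ s * (?M * p ^ s) \<le> (card C - 1) * (?M * p ^ s + 1)"
    using large by (intro mult_mono) auto
  moreover have "p ^ (2 * s + 1) > 0" using p0 by simp
  ultimately have "2 * (?M * p ^ s * (?M * p ^ s)) < p ^ (2 * s + 1)" by linarith
  hence "2 * ?M ^ 2 * (p ^ s) ^ 2 < p * (p ^ s) ^ 2"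
    by (simp add: power2_eq_square mult_ac power_mult power_even_eq)
  hence "2 * ?M ^ 2 < p" by simp
  hence "real (2 * ?M ^ 2) < real p" by (simp only: of_nat_less_iff)
  hence "2 * (real ?M)\<^sup>2 < real p" by simp
  moreover have "(sqrt (real p / 2))\<^sup>2 \<le> (real ?M)\<^sup>2"
    by (intro power_mono) (auto simp: real_nat_ceiling_ge)
  ultimately show False by simp
qed

lemma paley_clique_card_quadratic:
  fixes C :: "'a :: finite_field set"
  assumes "prime p" "p mod 4 = 1" "card (UNIV :: 'a set) = p ^ (2 * s + 1)"
    and "clique C paley_edges" "C \<noteq> {}"
  shows "(real (card C) - 1) * (real (card C) - (real p ^ s - 1) / 2)
    \<le> (real p ^ (2 * s + 1) - 1) / 2"
proof -
  define N where "N = card C"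
  define P where "P = p ^ s"
  define H where "H = (P - 1) div 2"
  define a where "a = (N - 1) div P"
  define r where "r = (if (N - 1) mod P < H then 0 else H)"
  have "odd p" using assms(2) by presburger
  hence oddP: "odd P" by (simp add: P_def)
  hence P: "P = 2 * H + 1" by (simp add: H_def)
  have N1: "N \<ge> 1" using assms(5) by (simp add: N_def Suc_le_eq card_gt_0_iff)
  have N: "N - 1 = a * P + (N - 1) mod P" by (simp add: a_def)
  have "N \<le> nat \<lceil>sqrt (real p / 2)\<rceil> * P"
    using paley_clique_card_le_ceiling[OF assms(1-4)] by (simp add: N_def P_def mult.commute)
  also have "\<dots> \<le> (p - 1) div 2 * P"
    using ceiling_sqrt_half_le[OF assms(1,2)] by simp
  finally have "N - 1 < (p - 1) div 2 * P" using N1 by linarith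
  hence a: "a \<le> (p - 1) div 2"
    unfolding a_def by (simp add: less_mult_imp_div_less less_imp_le)
  have "r = 0 \<or> r = (p ^ s - 1) div 2" by (simp add: r_def H_def P_def)
  moreover have "r \<le> (N - 1) mod P" by (simp add: r_def)
  hence "a * p ^ s + r < card C" using N N1 by (simp add: N_def P_def)
  ultimately have "(N - 1) * (a * P + r + 1) \<le> (p ^ (2 * s + 1) - 1) div 2"
    using paley_clique_card_mult_le[OF assms(1-4) a] by (simp add: N_def P_def)
  hence "real ((N - 1) * (a * P + r + 1)) \<le> real ((p ^ (2 * s + 1) - 1) div 2)"
    by (simp only: of_nat_le_iff)
  also have "\<dots> = (real p ^ (2 * s + 1) - 1) / 2"
  proof -
    have "odd (p ^ (2 * s + 1))" using \<open>odd p\<close> by simp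
    then obtain h where h: "p ^ (2 * s + 1) = 2 * h + 1" by (elim oddE)
    have "real p ^ (2 * s + 1) = real (p ^ (2 * s + 1))" by simp
    also have "\<dots> = 2 * real h + 1" unfolding h by simp
    finally show ?thesis unfolding h by simp
  qed
  finally have le: "(real N - 1) * real (a * P + r + 1) \<le> (real p ^ (2 * s + 1) - 1) / 2"
    unfolding of_nat_mult of_nat_diff[OF N1] of_nat_1 .
  \<comment> \<open>The residues \<open>0\<close> to \<open>2 * H\<close> split at \<open>H\<close>,
    so rounding down to \<open>r\<close> loses at most \<open>H\<close>.\<close>
  have "(N - 1) mod P \<le> 2 * H" using P mod_less_divisor[of P "N - 1"] by linarith
  hence "(N - 1) mod P \<le> r + H" by (auto simp: r_def)
  hence "N \<le> a * P + r + 1 + H" using N by linarith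
  hence "real N - real H \<le> real (a * P + r + 1)" by linarith
  hence "(real N - 1) * (real N - real H) \<le> (real N - 1) * real (a * P + r + 1)"
    using N1 by (intro mult_left_mono) auto
  moreover have "real P = 2 * real H + 1" by (subst P) simp
  hence "real H = (real p ^ s - 1) / 2" by (simp add: P_def)
  ultimately show ?thesis using le by (simp add: N_def)
qed

text \<open>Here \<open>x\<close> stands for \<open>sqrt (p / 2)\<close>, \<open>P\<close> for
  \<open>p ^ s\<close> and \<open>y\<close> for the clique size. The square is completed at
  \<open>(P + 1) / 4\<close>, the midpoint of the roots \<open>1\<close> and
  \<open>(P - 1) / 2\<close>.\<close>

lemma le_of_clique_quadratic:
  fixes x y P :: real
  assumes "x > 0" "P \<ge> 1"
    and "(y - 1) * (y - (P - 1) / 2) \<le> (P\<^sup>2 * (2 * x\<^sup>2) - 1) / 2"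
  shows "y \<le> P * x + (P + 1) / 4 + P / (32 * x)"
proof -
  have "(y - (P + 1) / 4)\<^sup>2 = (y - 1) * (y - (P - 1) / 2) + (P + 1)\<^sup>2 / 16 - (P - 1) / 2"
    by (simp add: power2_eq_square field_simps)
  also have "\<dots> \<le> (P\<^sup>2 * (2 * x\<^sup>2) - 1) / 2 + (P + 1)\<^sup>2 / 16 - (P - 1) / 2"
    using assms(3) by simp
  also have "\<dots> = P\<^sup>2 * x\<^sup>2 + P\<^sup>2 / 16 - (6 * P - 1) / 16"
    by (simp add: power2_eq_square field_simps)
  also have "\<dots> \<le> P\<^sup>2 * x\<^sup>2 + P\<^sup>2 / 16" using assms(2) by simp
  \<comment> \<open>The term \<open>P / (32 * x)\<close> is chosen so that twice its product with
    \<open>P * x\<close> is \<open>P ^ 2 / 16\<close>.\<close>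
  also have "\<dots> \<le> P\<^sup>2 * x\<^sup>2 + P\<^sup>2 / 16 + (P / (32 * x))\<^sup>2" by simp
  also have "\<dots> = (P * x + P / (32 * x))\<^sup>2"
    using assms(1) unfolding power2_sum by (simp add: power_mult_distrib power2_eq_square)
  finally have "y - (P + 1) / 4 \<le> P * x + P / (32 * x)"
    by (rule power2_le_imp_le) (use assms(1,2) in auto)
  thus ?thesis by simp
qed

theorem theorem1p7:
  fixes p s q :: nat
  assumes "prime p"
    and "p mod 4 = 1"
    and "q = p ^ (2 * s + 1)"
    and "card (UNIV :: 'a::finite_field set) = q"
  shows "real (clique_number (UNIV :: 'a set) paley_edges)
    \<le> min (real p ^ s * real_of_int \<lceil>sqrt (real p / 2)\<rceil>)
          (sqrt (real q / 2) + (real p ^ s + 1) / 4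
             + sqrt (2 * real p) / 32 * real p powi (int s - 1))"
proof -
  let ?S = "{card C | C. C \<subseteq> (UNIV :: 'a set) \<and> clique C paley_edges}"
  have "finite ?S" by simp
  \<comment> \<open>A singleton makes the set of clique sizes nonempty, so the maximum is attained,
    and by a nonempty clique.\<close>
  moreover have "clique ({0} :: 'a set) paley_edges" by (simp add: clique_def)
  hence "card ({0} :: 'a set) \<in> ?S" by blast
  ultimately have "Max ?S \<in> ?S" "card ({0} :: 'a set) \<le> Max ?S"
    using Max_in[of ?S] Max_ge[of ?S] by blast+
  then obtain C :: "'a set" where "clique C paley_edges" "card C = Max ?S" "card C \<ge> 1"
    by auto
  hence C: "clique C paley_edges" "clique_number (UNIV :: 'a set) paley_edges = card C" "C \<noteq> {}"
    by (auto simp: clique_number_def)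
  have card: "card (UNIV :: 'a set) = p ^ (2 * s + 1)" using assms by simp
  define x where "x = sqrt (real p / 2)"
  define P where "P = real p ^ s"
  define y where "y = real (card C)"
  have p0: "p > 0" using assms(1) prime_gt_0_nat by blast
  have x: "x > 0" "real p = 2 * x\<^sup>2" using p0 by (auto simp: x_def)
  have P: "P \<ge> 1" using p0 by (simp add: P_def)
  have q: "real q = P\<^sup>2 * (2 * x\<^sup>2)"
    using assms(3) x(2) by (simp add: P_def power_mult power_even_eq mult.commute)
  have "real (card C) \<le> real (p ^ s * nat \<lceil>x\<rceil>)"
    using paley_clique_card_le_ceiling[OF assms(1,2) card C(1)] unfolding x_def of_nat_le_iff .
  also have "\<dots> = P * real_of_int \<lceil>x\<rceil>" using x(1) by (simp add: P_def)
  finally have first: "y \<le> P * real_of_int \<lceil>x\<rceil>" by (simp add: y_def)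
  have "sqrt (real q / 2) = P * x"
    using P x(1) by (simp add: q real_sqrt_mult)
  moreover have "sqrt (2 * real p) = 2 * x"
    unfolding x(2) using x(1) by (simp add: real_sqrt_mult)
  \<comment> \<open>The exponent is \<open>-1\<close> when \<open>s = 0\<close>, hence the integer
    power; division by \<open>p = 2 * x ^ 2\<close> covers all \<open>s\<close>.\<close>
  moreover have "real p powi (int s - 1) = P / (2 * x\<^sup>2)"
    unfolding P_def x(2)[symmetric] using p0 by (simp add: power_int_diff)
  ultimately have rhs: "sqrt (real q / 2) + (real p ^ s + 1) / 4
      + sqrt (2 * real p) / 32 * real p powi (int s - 1)
      = P * x + (P + 1) / 4 + 2 * x / 32 * (P / (2 * x\<^sup>2))"
    by (simp only: P_def)
  have last: "2 * x / 32 * (P / (2 * x\<^sup>2)) = P / (32 * x)"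
    using x(1) by (simp add: power2_eq_square)
  have "(y - 1) * (y - (P - 1) / 2) \<le> (real q - 1) / 2"
    using paley_clique_card_quadratic[OF assms(1,2) card C(1,3)] assms(3)
    by (simp add: y_def P_def)
  hence "y \<le> P * x + (P + 1) / 4 + P / (32 * x)"
    using P x(1) unfolding q by (intro le_of_clique_quadratic)
  with first show ?thesis
    unfolding rhs last C(2) by (simp add: P_def x_def y_def)
qed

end
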